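(* For every integer $n\geq 3$, the cycle $C_n$ on $n$ vertices satisfies $b_{dR}(C_n)=1$ if $n\equiv 2$ or $n\equiv 4 \pmod 6$, and $b_{dR}(C_n)=2$ otherwise.
   Context: All graphs are finite, simple and undirected. For a graph $G=(V,E)$, a double Roman dominating function (DRDF) is a function $f:V\to\{0,1,2,3\}$ such that every vertex $v$ with $f(v)=0$ has at least two neighbors $u$ with $f(u)=2$ or at least one neighbor $w$ with $f(w)=3$, and every vertex $v$ with $f(v)=1$ has at least one neighbor $w$ with $f(w)\geq 2$. The weight of $f$ is $\sum_{u\in V}f(u)$, and $\gamma_{dR}(G)$ is the minimum weight of a DRDF on $G$. The double Roman bondage number $b_{dR}(G)$ of a graph $G$ with at least one edge is the minimum cardinality of an edge set $B\subseteq E(G)$ such that $\gamma_{dR}(G-B)>\gamma_{dR}(G)$, where $G-B$ is the spanning subgraph obtained by deleting the edges of $B$. *)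

theory Defs
  imports Main "HOL-Library.FuncSet"
begin

record 'a ugraph =
  verts :: "'a set"
  edges :: "'a set set"

text \<open>Edges are two-element vertex sets, so that an undirected edge counts once in a cardinality.\<close>

locale simple_graph =
  fixes G :: "'a ugraph"
  assumes finite_verts: "finite (verts G)"
    and edges_two_subsets: "e \<in> edges G \<Longrightarrow> e \<subseteq> verts G \<and> card e = 2"

definition nbrs :: "'a ugraph \<Rightarrow> 'a \<Rightarrow> 'a set" where
  "nbrs G v = {u \<in> verts G. {u, v} \<in> edges G}"

definition delete_edges :: "'a ugraph \<Rightarrow> 'a set set \<Rightarrow> 'a ugraph" where
  "delete_edges G B = \<lparr>verts = verts G, edges = edges G - B\<rparr>"

definition is_drdf :: "'a ugraph \<Rightarrow> ('a \<Rightarrow> nat) \<Rightarrow> bool" where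
  "is_drdf G f \<longleftrightarrow>
     f \<in> verts G \<rightarrow> {0, 1, 2, 3} \<and>
     (\<forall>v \<in> verts G. f v = 0 \<longrightarrow>
        card {u \<in> nbrs G v. f u = 2} \<ge> 2 \<or> (\<exists>w \<in> nbrs G v. f w = 3)) \<and>
     (\<forall>v \<in> verts G. f v = 1 \<longrightarrow> (\<exists>w \<in> nbrs G v. f w \<ge> 2))"

definition weight :: "'a ugraph \<Rightarrow> ('a \<Rightarrow> nat) \<Rightarrow> nat" where
  "weight G f = (\<Sum>u \<in> verts G. f u)"

definition gamma_dR :: "'a ugraph \<Rightarrow> nat" where
  "gamma_dR G = (LEAST w. \<exists>f. is_drdf G f \<and> weight G f = w)"

text \<open>Only meaningful for a graph with at least one edge; see \<open>b_dR_attained\<close>.\<close>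

definition b_dR :: "'a ugraph \<Rightarrow> nat" where
  "b_dR G = (LEAST k. \<exists>B \<subseteq> edges G. card B = k \<and> gamma_dR (delete_edges G B) > gamma_dR G)"

text \<open>For \<open>n < 3\<close> the following is not a cycle (and not even simple for \<open>n = 1\<close>).\<close>

definition cycle_graph :: "nat \<Rightarrow> nat ugraph" where
  "cycle_graph n = \<lparr>verts = {0..<n}, edges = {{i, Suc i mod n} | i. i < n}\<rparr>"

lemma gamma_dR_attained: "\<exists>f. is_drdf G f \<and> weight G f = gamma_dR G"
proof -
  have "is_drdf G (\<lambda>_. 2)"
    by (auto simp: is_drdf_def)
  then have "\<exists>w f. is_drdf G f \<and> weight G f = w"
    by blast
  then show ?thesis
    unfolding gamma_dR_def by (rule LeastI_ex)
qed

lemma gamma_dR_le: "is_drdf G f \<Longrightarrow> gamma_dR G \<le> weight G f"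
  unfolding gamma_dR_def by (rule Least_le) blast

lemma (in simple_graph) b_dR_attained:
  assumes "edges G \<noteq> {}"
  shows "\<exists>B \<subseteq> edges G. card B = b_dR G \<and> gamma_dR (delete_edges G B) > gamma_dR G"
proof -
  obtain e where "e \<in> edges G"
    using assms by blast
  then obtain u v where uv: "u \<noteq> v" "{u, v} \<in> edges G" "u \<in> verts G" "v \<in> verts G"
    using edges_two_subsets by (metis card_2_iff insert_subset)
  define f where "f = (\<lambda>x. if x = u then 3 else if x = v then 0 else 2 :: nat)"
  have "is_drdf G f"
    using uv by (auto simp: is_drdf_def f_def nbrs_def)
  then have "gamma_dR G \<le> weight G f"
    by (rule gamma_dR_le)
  also have "weight G f = f u + (f v + (\<Sum>x \<in> verts G - {u} - {v}. f x))"
    unfolding weight_def using uv finite_verts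
    by (metis DiffI finite_Diff singletonD sum.remove)
  also have "\<dots> < (\<Sum>x \<in> verts G. 2)"
  proof -
    have "(\<Sum>x \<in> verts G. 2 :: nat) = 2 + (2 + (\<Sum>x \<in> verts G - {u} - {v}. 2))"
      using uv finite_verts by (metis (no_types, lifting) DiffI finite_Diff singletonD sum.remove)
    moreover have "(\<Sum>x \<in> verts G - {u} - {v}. f x) = (\<Sum>x \<in> verts G - {u} - {v}. 2)"
      by (rule sum.cong) (auto simp: f_def)
    ultimately show ?thesis
      using uv by (simp add: f_def)
  qed
  also have "\<dots> \<le> gamma_dR (delete_edges G (edges G))"
  proof -
    obtain g where g: "is_drdf (delete_edges G (edges G)) g"
      "weight (delete_edges G (edges G)) g = gamma_dR (delete_edges G (edges G))"
      using gamma_dR_attained by blast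
    have "2 \<le> g x" if "x \<in> verts G" for x
      using g(1) that by (fastforce simp: is_drdf_def delete_edges_def nbrs_def)
    then show ?thesis
      using g(2) by (metis (no_types, lifting) delete_edges_def select_convs(1) sum_mono weight_def)
  qed
  finally have "\<exists>k. \<exists>B \<subseteq> edges G. card B = k \<and> gamma_dR (delete_edges G B) > gamma_dR G"
    by blast
  then show ?thesis
    unfolding b_dR_def by (rule LeastI_ex)
qed

lemma simple_graph_cycle_graph: "n \<ge> 3 \<Longrightarrow> simple_graph (cycle_graph n)"
proof
  show "finite (verts (cycle_graph n))"
    by (simp add: cycle_graph_def)
next
  fix e
  assume n: "n \<ge> 3" and "e \<in> edges (cycle_graph n)"
  then obtain i where i: "i < n" "e = {i, Suc i mod n}"
    by (auto simp: cycle_graph_def)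
  moreover have "i \<noteq> Suc i mod n" "Suc i mod n < n"
    using n i by (auto simp: mod_Suc)
  ultimately show "e \<subseteq> verts (cycle_graph n) \<and> card e = 2"
    by (simp add: cycle_graph_def)
qed

end

theory Submission
  imports Defs
begin

text \<open>
  Discharging: every vertex of value 3 (respectively 2) passes charge 1 (respectively 1/2) to each
  neighbour of value 0. If all degrees are at most 2, every vertex ends up with charge at least 1,
  so a double Roman dominating function weighs at least the number of vertices. Equality forces
  the pattern 0 3 0 0 3 0 ... on a path, and one of the patterns 3 0 0 ... and 2 0 ... around a
  cycle. Hence a path on \<open>m\<close> vertices needs \<open>m\<close> if \<open>3 dvd m\<close> and \<open>m + 1\<close> otherwise,
  while \<open>C\<^sub>n\<close> needs \<open>n\<close> if 2 or 3 divides \<open>n\<close> and \<open>n + 1\<close> otherwise. Deleting one edge leaves a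
  path on \<open>n\<close> vertices, and deleting two suitable edges leaves two paths that are too expensive.
\<close>

section \<open>Discharging on sequences\<close>

text \<open>
  The value 1 neither dominates nor takes part in the exchange of charge, so it also serves as a
  stand-in for a missing neighbour.
\<close>

definition dominated :: "nat \<Rightarrow> nat \<Rightarrow> nat \<Rightarrow> bool" where
  "dominated a b c \<longleftrightarrow> b \<le> 3 \<and> (b = 0 \<longrightarrow> a = 3 \<or> c = 3 \<or> a = 2 \<and> c = 2) \<and>
     (b = 1 \<longrightarrow> a \<ge> 2 \<or> c \<ge> 2)"

definition transfer :: "nat \<Rightarrow> nat \<Rightarrow> int" where
  "transfer a b = (if b = 0 then if a = 3 then 2 else if a = 2 then 1 else 0 else 0)"

text \<open>Net charge moving from the left entry to the right one; in a sum over consecutive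
  entries these terms cancel.\<close>

definition flow :: "nat \<Rightarrow> nat \<Rightarrow> int" where
  "flow a b = transfer a b - transfer b a"

text \<open>Charges are doubled to keep them integral.\<close>

definition charge :: "nat \<Rightarrow> nat \<Rightarrow> nat \<Rightarrow> int" where
  "charge a b c = 2 * int b + flow a b - flow b c"

lemmas charge_defs = charge_def flow_def transfer_def

lemma le_3_cases:
  fixes b :: nat
  assumes "b \<le> 3"
  obtains "b = 0" | "b = 1" | "b = 2" | "b = 3"
  using assms by linarith

text \<open>In doubled units a 3 starts with 6 and gives away at most 4, a 2 starts with 4 and gives
  away at most 2, a 1 keeps its 2, and a dominated 0 receives 2 from one 3 or 1 from each of two
  2s.\<close>

lemma charge_ge_2: "dominated a b c \<Longrightarrow> charge a b c \<ge> 2"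
  by (rule le_3_cases[of b]) (auto simp: dominated_def charge_defs)

lemma dominated_1_left: "dominated a 1 c \<Longrightarrow> a < 2 \<Longrightarrow> c \<ge> 2"
  by (auto simp: dominated_def)

text \<open>Only zeros draw charge, and a 2 or 3 drops to exactly 2 only if both neighbours draw
  from it.\<close>

lemma charge_ge_2_tight:
  assumes "dominated a b c" "charge a b c = 2" "b \<ge> 2"
  shows "a = 0 \<and> c = 0"
proof -
  have "b = 2 \<or> b = 3"
    using assms by (auto simp: dominated_def)
  then show ?thesis
    using assms(2) by (auto simp: charge_defs split: if_splits)
qed

text \<open>One 3 already saturates the zero, so any contribution from the other side would exceed
  2.\<close>

lemma charge_tight_right_of_3: "charge 3 0 c = 2 \<Longrightarrow> c \<noteq> 2 \<and> c \<noteq> 3"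
  by (auto simp: charge_defs split: if_splits)

lemma charge_tight_right_of_2: "dominated 2 0 c \<Longrightarrow> charge 2 0 c = 2 \<Longrightarrow> c = 2"
  by (auto simp: dominated_def charge_defs split: if_splits)

text \<open>The stand-in 1 helps no neighbour, so putting the true value back cannot destroy
  domination. This gives monotonicity of \<open>gamma_dR\<close> under edge deletion.\<close>

lemma dominated_restore:
  "dominated (if P then 1 else a) b (if Q then 1 else c) \<Longrightarrow> dominated a b c"
  by (auto simp: dominated_def split: if_splits)

text \<open>The flows telescope, leaving only those at the two ends.\<close>

lemma sum_charge:
  "(\<Sum>j<m. charge (F j) (F (Suc j)) (F (Suc (Suc j)))) =
     2 * int (\<Sum>j<m. F (Suc j)) + flow (F 0) (F 1) - flow (F m) (F (Suc m))"
  by (induction m) (simp_all add: charge_def)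

lemma tight_of_sum_eq:
  fixes g :: "nat \<Rightarrow> int"
  assumes "\<And>j. j < m \<Longrightarrow> g j \<ge> 2" "(\<Sum>j<m. g j) \<le> 2 * int m" "j < m"
  shows "g j = 2"
proof (rule ccontr)
  assume "g j \<noteq> 2"
  then have "g j > 2"
    using assms(1,3) by (simp add: order_less_le)
  then have "(\<Sum>j<m. 2) < (\<Sum>j<m. g j)"
    using assms(1,3) by (intro sum_strict_mono_ex1) auto
  then show False
    using assms(2) by simp
qed

text \<open>The path is \<open>F 1\<close>, ..., \<open>F m\<close>; the outer entries are stand-ins
  that exchange no charge, so the charges sum to twice the weight. Weight \<open>m\<close> makes
  every charge tight, which cuts the path into blocks 0 3 0.\<close>

lemma path_weight_ge:
  assumes ends: "F 0 = 1" "F (Suc m) = 1"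
    and dom: "\<And>j. j < m \<Longrightarrow> dominated (F j) (F (Suc j)) (F (Suc (Suc j)))"
  shows "m + (if 3 dvd m then 0 else 1) \<le> (\<Sum>j<m. F (Suc j))"
proof -
  let ?c = "\<lambda>j. charge (F j) (F (Suc j)) (F (Suc (Suc j)))"
  let ?w = "\<Sum>j<m. F (Suc j)"
  have ge: "?c j \<ge> 2" if "j < m" for j
    using dom[OF that] by (rule charge_ge_2)
  have sum: "(\<Sum>j<m. ?c j) = 2 * int ?w"
    using ends by (simp only: sum_charge) (simp add: flow_def transfer_def)
  have "(\<Sum>j<m. 2) \<le> (\<Sum>j<m. ?c j)"
    using ge by (intro sum_mono) auto
  then have "m \<le> ?w"
    unfolding sum by (simp del: of_nat_sum)
  moreover have "3 dvd m" if "?w = m"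
  proof -
    have tight: "?c j = 2" if "j < m" for j
      using tight_of_sum_eq[of m ?c j] ge sum \<open>?w = m\<close> that by auto
    have outer: "F j = 0 \<and> F (Suc (Suc j)) = 0" if "F (Suc j) \<ge> 2" "j < m" for j
      using charge_ge_2_tight[OF dom tight] that by blast
    \<comment> \<open>Entry \<open>j\<close> is the left stand-in or the end of a block. The next
      three entries turn out to be 0 3 0, and the assumption on two consecutive entries recurs three
      places further on.\<close>
    have step: "j + 3 \<le> m \<and> F (j + 3) < 2 \<and> F (j + 4) < 2"
      if j: "F j < 2" "F (j + 1) < 2" "j < m" for j
    proof -
      \<comment> \<open>A 1 here would need an entry at least 2 on its right, but tightness gives
        such an entry only zeros as neighbours.\<close>
      have j1: "F (j + 1) = 0"
      proof (rule ccontr)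
        assume "F (j + 1) \<noteq> 0"
        then have 1: "F (Suc j) = 1"
          using j(2) by simp
        then have 2: "F (Suc (Suc j)) \<ge> 2"
          using dominated_1_left dom j(1,3) by metis
        then have "Suc j \<noteq> m"
          using ends by auto
        then show False
          using outer[of "Suc j"] 1 2 j(3) by auto
      qed
      then have j2: "F (Suc (Suc j)) = 3"
        using dom[of j] j by (auto simp: dominated_def)
      then have m2: "Suc j < m"
        using ends j(3) by (cases "Suc j = m") auto
      then have j3: "F (Suc (Suc (Suc j))) = 0"
        using outer[of "Suc j"] j2 by simp
      then have m3: "Suc (Suc j) < m"
        using ends m2 by (cases "Suc (Suc j) = m") auto
      have "F (j + 4) \<noteq> 2 \<and> F (j + 4) \<noteq> 3"
        using tight[OF m3] j2 j3 charge_tight_right_of_3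
        by (simp add: eval_nat_numeral)
      moreover have "F (j + 4) \<le> 3"
      proof (cases "j + 3 < m")
        case True
        then show ?thesis
          using dom[of "j + 3"] by (simp add: dominated_def eval_nat_numeral)
      next
        case False
        then have "j + 4 = Suc m"
          using m3 by simp
        then show ?thesis
          using ends(2) by (metis one_le_numeral)
      qed
      ultimately show ?thesis
        using j3 m3 by (simp add: eval_nat_numeral)
    qed
    \<comment> \<open>A first entry of at least 2 would force the left stand-in to be 0 instead of
      1.\<close>
    have start: "F 1 < 2" if "0 < m"
      using outer[of 0] ends that by force
    have "3 * k < m \<longrightarrow> F (3 * k) < 2 \<and> F (3 * k + 1) < 2" for k
    proof (induction k)
      case 0
      then show ?case
        using start ends by simp
    next
      case (Suc k)
      then show ?case
        using step[of "3 * k"] by (simp add: eval_nat_numeral)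
    qed
    then have "3 * k < m \<longrightarrow> 3 * k + 3 \<le> m" for k
      using step[of "3 * k"] by blast
    \<comment> \<open>If \<open>3 * (m div 3)\<close> were less than \<open>m\<close>, a whole
      further block would have to fit.\<close>
    from this[of "m div 3"] show "3 dvd m"
      by presburger
  qed
  ultimately show ?thesis
    by (cases "?w = m") auto
qed

text \<open>The labelling is unrolled to a periodic sequence, so the end flows cancel. In the tight
  case a 2 recurs every 2 places, a 3 every 3 places, and each is followed by 0. If that step did
  not divide \<open>n\<close>, going around would land on this 0.\<close>

lemma cycle_weight_ge:
  assumes "n > 0" and per: "\<And>j. F (j + n) = F j"
    and dom: "\<And>j. dominated (F j) (F (Suc j)) (F (Suc (Suc j)))"
  shows "n + (if 2 dvd n \<or> 3 dvd n then 0 else 1) \<le> (\<Sum>j<n. F j)"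
proof -
  let ?c = "\<lambda>j. charge (F j) (F (Suc j)) (F (Suc (Suc j)))"
  let ?w = "\<Sum>j<n. F j"
  have ge: "?c j \<ge> 2" for j
    using dom by (rule charge_ge_2)
  have shift: "(\<Sum>j<n. F (Suc j)) = ?w"
    using sum.lessThan_Suc_shift[of F n] per[of 0] by simp
  have sum: "(\<Sum>j<n. ?c j) = 2 * int ?w"
    using per[of 0] per[of 1] by (simp only: sum_charge shift) simp
  have "(\<Sum>j<n. 2) \<le> (\<Sum>j<n. ?c j)"
    using ge by (intro sum_mono) auto
  then have "n \<le> ?w"
    unfolding sum by (simp del: of_nat_sum)
  moreover have "2 dvd n \<or> 3 dvd n" if "?w = n"
  proof -
    have perk: "F (j + k * n) = F j" for j k
      by (induction k) (simp_all add: add.assoc[symmetric] per add.commute[of n] add.left_commute[of _ n])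
    have tight_lt: "?c j = 2" if "j < n" for j
      using tight_of_sum_eq[of n ?c j] ge sum \<open>?w = n\<close> that by auto
    have tight: "?c j = 2" for j
    proof -
      have "F (j + i) = F (j mod n + i)" for i
        using perk[of "j mod n + i" "j div n"] by (metis add.commute add.left_commute div_mult_mod_eq)
      from this[of 0] this[of 1] this[of 2] show ?thesis
        using tight_lt[of "j mod n"] \<open>n > 0\<close> by (simp add: eval_nat_numeral)
    qed
    have outer: "F j = 0 \<and> F (Suc (Suc j)) = 0" if "F (Suc j) \<ge> 2" for j
      using charge_ge_2_tight[OF dom tight] that by blast
    \<comment> \<open>The index \<open>j + n - 1\<close> serves as the predecessor of
      \<open>j\<close> modulo \<open>n\<close>, without truncation at 0.\<close>
    have next_0: "F (Suc j) = 0" if "F j \<ge> 2" for j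
      using outer[of "j + n - 1"] that \<open>n > 0\<close> per[of j] per[of "Suc j"] by simp
    have le_3: "F j \<le> 3" for j
      using dom[of "j + n - 1"] \<open>n > 0\<close> per[of j] by (simp add: dominated_def)
    have step_2: "F (j + 2) = 2" if "F j = 2" for j
      using charge_tight_right_of_2[of "F (j + 2)"] dom[of j] tight[of j] next_0[of j] that by simp
    have step_3: "F (j + 3) = 3" if "F j = 3" for j
    proof -
      have 1: "F (Suc j) = 0"
        using next_0 that by simp
      then have "F (Suc (Suc j)) < 2"
        using charge_tight_right_of_3[of "F (Suc (Suc j))"] tight[of j] that le_3[of "Suc (Suc j)"]
        by fastforce
      moreover have "F (Suc (Suc j)) \<noteq> 1"
        using dominated_1_left[of "F (Suc j)" "F (Suc (Suc (Suc j)))"] dom[of "Suc j"] 1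
          outer[of "Suc (Suc j)"] by fastforce
      ultimately have "F (Suc (Suc j)) = 0"
        by simp
      then show ?thesis
        using dom[of "Suc j"] 1 by (simp add: dominated_def eval_nat_numeral)
    qed
    \<comment> \<open>A middle entry 0 or 1 needs a neighbour of at least 2, so three consecutive
      entries suffice.\<close>
    have "F 0 \<ge> 2 \<or> F (Suc 0) \<ge> 2 \<or> F (Suc (Suc 0)) \<ge> 2"
      using dom[of 0] by (cases rule: le_3_cases[OF le_3, of "Suc 0"]) (auto simp: dominated_def)
    then obtain i where i: "F i \<ge> 2"
      by blast
    show ?thesis
    proof (cases "F i = 2")
      case True
      have "F (i + 2 * k) = 2" for k
        by (induction k) (use True step_2 in \<open>auto simp: add.assoc[symmetric] add.commute[of 2]\<close>)
      moreover have "F (Suc i) = 0"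
        using next_0 i by blast
      \<comment> \<open>For odd \<open>n\<close>, going around once in steps of 2 ends at
        \<open>i + 1 + n\<close>, which carries the same value as \<open>i + 1\<close>.\<close>
      moreover have "F (Suc i) = F (i + 2 * (Suc n div 2))" if "odd n"
        using that per[of "Suc i"] by simp
      ultimately show ?thesis
        by fastforce
    next
      case False
      then have 3: "F i = 3"
        using i le_3[of i] by simp
      have k: "F (i + 3 * k) = 3" for k
        by (induction k) (use 3 step_3 in \<open>auto simp: add.assoc[symmetric] add.commute[of 3]\<close>)
      have 1: "F (i + 1) = 0"
        using next_0 i by simp
      \<comment> \<open>Here 3 divides \<open>2 * n + 1\<close>, so going around twice in steps of 3
        hits the zero at \<open>i + 1\<close>; in the other case once is enough.\<close>
      have "n mod 3 \<noteq> 1"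
      proof
        assume "n mod 3 = 1"
        then have "i + 1 + 2 * n = i + 3 * ((2 * n + 1) div 3)"
          by presburger
        then show False
          using perk[of "i + 1" 2] 1 k[of "(2 * n + 1) div 3"] by (metis zero_neq_numeral)
      qed
      moreover have "n mod 3 \<noteq> 2"
      proof
        assume "n mod 3 = 2"
        then have "i + 1 + n = i + 3 * ((n + 1) div 3)"
          by presburger
        then show False
          using per[of "i + 1"] 1 k[of "(n + 1) div 3"] by (metis zero_neq_numeral)
      qed
      ultimately show ?thesis
        by presburger
    qed
  qed
  ultimately show ?thesis
    by (cases "?w = n") auto
qed

section \<open>Cycles with deleted edges\<close>

definition cyc_pred :: "nat \<Rightarrow> nat \<Rightarrow> nat" where
  "cyc_pred n v = (if v = 0 then n - 1 else v - 1)"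

definition cyc_succ :: "nat \<Rightarrow> nat \<Rightarrow> nat" where
  "cyc_succ n v = (if Suc v = n then 0 else Suc v)"

lemma cyc_succ_eq_mod: "v < n \<Longrightarrow> Suc v mod n = cyc_succ n v"
  by (auto simp: cyc_succ_def)

lemma edges_cycle_graph: "edges (cycle_graph n) = {{i, cyc_succ n i} | i. i < n}"
  unfolding cycle_graph_def using cyc_succ_eq_mod by fastforce

lemma cyc_succ_edge: "i < n \<Longrightarrow> {i, cyc_succ n i} \<in> edges (cycle_graph n)"
  by (auto simp: edges_cycle_graph)

lemma nbrs_delete_edges_cycle_graph:
  assumes "n \<ge> 3" "v < n"
  shows "nbrs (delete_edges (cycle_graph n) B) v =
    {u. u = cyc_pred n v \<and> {u, v} \<notin> B \<or> u = cyc_succ n v \<and> {v, u} \<notin> B}"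
proof -
  have "u < n \<and> {u, v} \<in> edges (cycle_graph n) \<longleftrightarrow> u = cyc_pred n v \<or> u = cyc_succ n v" for u
  proof -
    have "{u, v} \<in> edges (cycle_graph n) \<longleftrightarrow> u < n \<and> v = cyc_succ n u \<or> v < n \<and> u = cyc_succ n v"
      unfolding edges_cycle_graph by (auto simp: doubleton_eq_iff)
    moreover have "u < n \<and> v = cyc_succ n u \<longleftrightarrow> u = cyc_pred n v"
      using assms by (cases v) (auto simp: cyc_pred_def cyc_succ_def)
    moreover have "cyc_succ n v < n"
      using assms by (simp add: cyc_succ_def)
    ultimately show ?thesis
      using assms(2) by blast
  qed
  moreover have "verts (cycle_graph n) = {0..<n}"
    by (simp add: cycle_graph_def)
  ultimately show ?thesis
    by (auto simp: nbrs_def delete_edges_def insert_commute)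
qed

lemma card_subset_pair_ge_2:
  assumes "x \<noteq> y"
  shows "card {u. (u = x \<and> P u \<or> u = y \<and> Q u)} \<ge> 2 \<longleftrightarrow> P x \<and> Q y"
proof -
  have "{u. (u = x \<and> P u \<or> u = y \<and> Q u)} = (if P x then {x} else {}) \<union> (if Q y then {y} else {})"
    by auto
  then show ?thesis
    using assms by simp
qed

text \<open>Deleting an edge amounts to reading the lost neighbour as 1. For
  \<open>n \<ge> 3\<close> the two cyclic neighbours are distinct, so counting neighbours of value 2
  becomes a condition on both sides.\<close>

lemma is_drdf_delete_edges_cycle_graph:
  assumes "n \<ge> 3"
  shows "is_drdf (delete_edges (cycle_graph n) B) f \<longleftrightarrow>
    (\<forall>v<n. dominated (if {cyc_pred n v, v} \<in> B then 1 else f (cyc_pred n v)) (f v)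
      (if {v, cyc_succ n v} \<in> B then 1 else f (cyc_succ n v)))"
proof -
  let ?G = "delete_edges (cycle_graph n) B"
  have verts: "verts ?G = {0..<n}"
    by (simp add: delete_edges_def cycle_graph_def)
  let ?drdf_at = "\<lambda>v. f v \<in> {0, 1, 2, 3} \<and>
    (f v = 0 \<longrightarrow> card {u \<in> nbrs ?G v. f u = 2} \<ge> 2 \<or> (\<exists>w \<in> nbrs ?G v. f w = 3)) \<and>
    (f v = 1 \<longrightarrow> (\<exists>w \<in> nbrs ?G v. f w \<ge> 2))"
  have eq: "?drdf_at v \<longleftrightarrow>
    dominated (if {cyc_pred n v, v} \<in> B then 1 else f (cyc_pred n v)) (f v)
      (if {v, cyc_succ n v} \<in> B then 1 else f (cyc_succ n v))" if v: "v < n" for v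
  proof -
    have ne: "cyc_pred n v \<noteq> cyc_succ n v"
      using assms v by (auto simp: cyc_pred_def cyc_succ_def)
    have "{u \<in> nbrs ?G v. f u = 2} = {u. (u = cyc_pred n v \<and> ({u, v} \<notin> B \<and> f u = 2) \<or>
        u = cyc_succ n v \<and> ({v, u} \<notin> B \<and> f u = 2))}"
      unfolding nbrs_delete_edges_cycle_graph[OF assms v] by auto
    then have card: "card {u \<in> nbrs ?G v. f u = 2} \<ge> 2 \<longleftrightarrow>
        ({cyc_pred n v, v} \<notin> B \<and> f (cyc_pred n v) = 2) \<and>
        ({v, cyc_succ n v} \<notin> B \<and> f (cyc_succ n v) = 2)"
      by (simp only: card_subset_pair_ge_2[OF ne])
    have ex: "(\<exists>w \<in> nbrs ?G v. P w) \<longleftrightarrow> {cyc_pred n v, v} \<notin> B \<and> P (cyc_pred n v) \<or>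
        {v, cyc_succ n v} \<notin> B \<and> P (cyc_succ n v)" for P
      unfolding nbrs_delete_edges_cycle_graph[OF assms v] by auto
    have range: "f v \<in> {0, 1, 2, 3} \<longleftrightarrow> f v \<le> 3"
      by auto
    show ?thesis
      unfolding dominated_def card ex range
      by (cases "{cyc_pred n v, v} \<in> B"; cases "{v, cyc_succ n v} \<in> B") auto
  qed
  have "is_drdf ?G f \<longleftrightarrow> (\<forall>v<n. ?drdf_at v)"
    unfolding is_drdf_def verts Pi_iff Ball_def atLeastLessThan_iff by (simp only: le0 simp_thms) blast
  then show ?thesis
    using eq by (simp only: cong: imp_cong)
qed

lemma delete_edges_empty: "delete_edges G {} = (G :: 'a ugraph)"
  by (simp add: delete_edges_def)

lemma weight_delete_edges_cycle_graph: "weight (delete_edges (cycle_graph n) B) f = (\<Sum>v<n. f v)"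
  by (simp add: weight_def delete_edges_def cycle_graph_def lessThan_atLeast0)

lemma gamma_dR_delete_edges_cycle_graph_le:
  assumes "n \<ge> 3"
    "\<And>v. v < n \<Longrightarrow> dominated (if {cyc_pred n v, v} \<in> B then 1 else f (cyc_pred n v)) (f v)
      (if {v, cyc_succ n v} \<in> B then 1 else f (cyc_succ n v))"
  shows "gamma_dR (delete_edges (cycle_graph n) B) \<le> (\<Sum>v<n. f v)"
  using gamma_dR_le[of "delete_edges (cycle_graph n) B" f] assms
    is_drdf_delete_edges_cycle_graph weight_delete_edges_cycle_graph by metis

lemma gamma_dR_delete_edges_cycle_graph_attained:
  assumes "n \<ge> 3"
  obtains f where "gamma_dR (delete_edges (cycle_graph n) B) = (\<Sum>v<n. f v)"
    "\<And>v. v < n \<Longrightarrow> dominated (if {cyc_pred n v, v} \<in> B then 1 else f (cyc_pred n v)) (f v)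
      (if {v, cyc_succ n v} \<in> B then 1 else f (cyc_succ n v))"
  using gamma_dR_attained[of "delete_edges (cycle_graph n) B"] assms
    is_drdf_delete_edges_cycle_graph weight_delete_edges_cycle_graph by metis

section \<open>Lower bounds for cycles, with and without deleted edges\<close>

lemma gamma_dR_cycle_graph_ge:
  assumes "n \<ge> 3"
  shows "gamma_dR (cycle_graph n) \<ge> n + (if 2 dvd n \<or> 3 dvd n then 0 else 1)"
proof -
  obtain f where f: "gamma_dR (cycle_graph n) = (\<Sum>v<n. f v)"
    "\<And>v. v < n \<Longrightarrow> dominated (f (cyc_pred n v)) (f v) (f (cyc_succ n v))"
    using gamma_dR_delete_edges_cycle_graph_attained[OF assms, of "{}"]
    unfolding delete_edges_empty by (simp only: empty_iff if_False) blast
  let ?F = "\<lambda>j. f (j mod n)"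
  have "dominated (?F j) (?F (Suc j)) (?F (Suc (Suc j)))" for j
  proof -
    have "cyc_pred n (Suc j mod n) = j mod n"
      using assms by (auto simp: cyc_pred_def mod_Suc)
    moreover have "cyc_succ n (Suc j mod n) = Suc (Suc j) mod n"
      using assms cyc_succ_eq_mod[of "Suc j mod n" n] by (simp add: mod_Suc_eq)
    ultimately show ?thesis
      using f(2)[of "Suc j mod n"] assms by simp
  qed
  then have "n + (if 2 dvd n \<or> 3 dvd n then 0 else 1) \<le> (\<Sum>j<n. ?F j)"
    using assms by (intro cycle_weight_ge) auto
  then show ?thesis
    using f(1) by simp
qed

text \<open>The vertices from \<open>a\<close> to \<open>b - 1\<close> lie between two deleted edge
  ends and form a path, to which \<open>path_weight_ge\<close> applies.\<close>

lemma segment_weight_ge: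
  assumes dom: "\<And>v. v < n \<Longrightarrow>
      dominated (if {cyc_pred n v, v} \<in> B then 1 else f (cyc_pred n v)) (f v)
        (if {v, cyc_succ n v} \<in> B then 1 else f (cyc_succ n v))"
    and "a < b" "b \<le> n"
    and first: "{cyc_pred n a, a} \<in> B" and last: "{b - 1, cyc_succ n (b - 1)} \<in> B"
    and inner: "\<And>v. a < v \<Longrightarrow> v < b \<Longrightarrow> {v - 1, v} \<notin> B"
  shows "b - a + (if 3 dvd b - a then 0 else 1) \<le> (\<Sum>v=a..<b. f v)"
proof -
  \<comment> \<open>Indices shift by one: vertex \<open>a + j\<close> sits at \<open>Suc j\<close>,
    which leaves both ends free for the stand-in 1.\<close>
  define F where "F j = (if j = 0 \<or> j = Suc (b - a) then 1 else f (a + j - 1))" for j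
  have "dominated (F j) (F (Suc j)) (F (Suc (Suc j)))" if j: "j < b - a" for j
  proof -
    have "F j = (if {cyc_pred n (a + j), a + j} \<in> B then 1 else f (cyc_pred n (a + j)))"
      using first inner[of "a + j"] j by (cases j) (auto simp: F_def cyc_pred_def)
    moreover have "F (Suc j) = f (a + j)"
      using j by (simp add: F_def)
    moreover have "F (Suc (Suc j)) =
        (if {a + j, cyc_succ n (a + j)} \<in> B then 1 else f (cyc_succ n (a + j)))"
    proof (cases "Suc j = b - a")
      case True
      then have "a + j = b - 1"
        by simp
      then show ?thesis
        using last True by (simp add: F_def)
    next
      case False
      then show ?thesis
        using inner[of "Suc (a + j)"] j \<open>b \<le> n\<close> by (auto simp: F_def cyc_succ_def)
    qed
    ultimately show ?thesis
      using dom[of "a + j"] j \<open>b \<le> n\<close> by simp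
  qed
  then have "b - a + (if 3 dvd b - a then 0 else 1) \<le> (\<Sum>j<b - a. F (Suc j))"
    by (intro path_weight_ge) (auto simp: F_def)
  also have "\<dots> = (\<Sum>j<b - a. f (a + j))"
    by (intro sum.cong) (auto simp: F_def)
  also have "\<dots> = (\<Sum>v=a..<b. f v)"
    using \<open>a < b\<close> by (simp add: sum.atLeastLessThan_shift_0[of f a b] lessThan_atLeast0)
  finally show ?thesis .
qed

lemma gamma_dR_cycle_graph_delete_edge_ge:
  assumes "n \<ge> 3"
  shows "gamma_dR (delete_edges (cycle_graph n) {{n - 1, 0}}) \<ge> n + (if 3 dvd n then 0 else 1)"
proof -
  let ?B = "{{n - 1, 0 :: nat}}"
  obtain f where f: "gamma_dR (delete_edges (cycle_graph n) ?B) = (\<Sum>v<n. f v)"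
    "\<And>v. v < n \<Longrightarrow> dominated (if {cyc_pred n v, v} \<in> ?B then 1 else f (cyc_pred n v)) (f v)
      (if {v, cyc_succ n v} \<in> ?B then 1 else f (cyc_succ n v))"
    using gamma_dR_delete_edges_cycle_graph_attained[OF assms] by blast
  have "n - 0 + (if 3 dvd n - 0 then 0 else 1) \<le> (\<Sum>v=0..<n. f v)"
    by (rule segment_weight_ge[OF f(2)])
      (use assms in \<open>auto simp: cyc_pred_def cyc_succ_def doubleton_eq_iff\<close>)
  then show ?thesis
    using f(1) by (simp add: lessThan_atLeast0)
qed

lemma gamma_dR_cycle_graph_delete_two_edges_ge:
  assumes "n \<ge> 3" "0 < a" "a + 1 < n"
  shows "gamma_dR (delete_edges (cycle_graph n) {{n - 1, 0}, {a - 1, a}}) \<ge>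
    n + (if 3 dvd a then 0 else 1) + (if 3 dvd n - a then 0 else 1)"
proof -
  let ?B = "{{n - 1, 0}, {a - 1, a}}"
  obtain f where f: "gamma_dR (delete_edges (cycle_graph n) ?B) = (\<Sum>v<n. f v)"
    "\<And>v. v < n \<Longrightarrow> dominated (if {cyc_pred n v, v} \<in> ?B then 1 else f (cyc_pred n v)) (f v)
      (if {v, cyc_succ n v} \<in> ?B then 1 else f (cyc_succ n v))"
    using gamma_dR_delete_edges_cycle_graph_attained[OF assms(1)] by blast
  have "a - 0 + (if 3 dvd a - 0 then 0 else 1) \<le> (\<Sum>v=0..<a. f v)"
    by (rule segment_weight_ge[OF f(2)])
      (use assms in \<open>auto simp: cyc_pred_def cyc_succ_def doubleton_eq_iff\<close>)
  moreover have "n - a + (if 3 dvd n - a then 0 else 1) \<le> (\<Sum>v=a..<n. f v)"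
    by (rule segment_weight_ge[OF f(2)])
      (use assms in \<open>auto simp: cyc_pred_def cyc_succ_def doubleton_eq_iff\<close>)
  moreover have "(\<Sum>v=0..<a. f v) + (\<Sum>v=a..<n. f v) = (\<Sum>v<n. f v)"
    using assms sum.atLeastLessThan_concat[of 0 a n f] by (simp add: lessThan_atLeast0)
  ultimately show ?thesis
    using f(1) assms by simp
qed

section \<open>Upper bounds and monotonicity under deletion\<close>

text \<open>Blocks 0 3 0 along a path. A remainder of one vertex gets 2, and a remainder of two
  vertices gets 0 3, so either remainder costs one extra.\<close>

definition path_drdf :: "nat \<Rightarrow> nat \<Rightarrow> nat" where
  "path_drdf n j = (if j mod 3 = 1 then 3 else if j mod 3 = 0 \<and> Suc j = n then 2 else 0)"

lemma sum_path_drdf: "(\<Sum>j<n. path_drdf n j) = n + (if 3 dvd n then 0 else 1)"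
proof -
  \<comment> \<open>The exceptional 2 can occur only at the last index, so it is split off and the
    plain pattern is summed first.\<close>
  have body: "(\<Sum>j<k. if j mod 3 = 1 then 3 else 0) = (if k mod 3 = 2 then k + 1 else k - k mod 3)"
    for k :: nat
  proof (induction k)
    case (Suc k)
    have "k mod 3 = 0 \<or> k mod 3 = 1 \<or> k mod 3 = 2"
      by presburger
    then show ?case
      using Suc by (auto simp: mod_Suc)
  qed simp
  show ?thesis
  proof (cases n)
    case (Suc k)
    have "(\<Sum>j<k. path_drdf n j) = (\<Sum>j<k. if j mod 3 = 1 then 3 else 0)"
      by (intro sum.cong) (auto simp: path_drdf_def Suc)
    moreover have "k mod 3 = 0 \<or> k mod 3 = 1 \<or> k mod 3 = 2"
      by presburger
    moreover have "3 dvd Suc k \<longleftrightarrow> k mod 3 = 2"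
      by presburger
    moreover have "k mod 3 \<le> k"
      by simp
    ultimately show ?thesis
      unfolding Suc sum.lessThan_Suc body by (elim disjE) (simp_all add: path_drdf_def)
  qed simp
qed

lemma gamma_dR_cycle_graph_delete_edge_le:
  assumes "n \<ge> 3" "e \<in> edges (cycle_graph n)"
  shows "gamma_dR (delete_edges (cycle_graph n) {e}) \<le> n + (if 3 dvd n then 0 else 1)"
proof -
  obtain i where i: "i < n" "e = {i, cyc_succ n i}"
    using assms(2) by (auto simp: edges_cycle_graph)
  \<comment> \<open>Rotation that puts the deleted edge between the last and the first position:
    \<open>i\<close> goes to \<open>n - 1\<close> and its successor to 0.\<close>
  define pos where "pos v = (if v \<le> i then v + n - Suc i else v - Suc i)" for v
  have "bij_betw pos {..<n} {..<n}"
    using i by (intro bij_betw_byWitness[where f' = "\<lambda>j. if j + Suc i < n then j + Suc i else j + Suc i - n"])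
      (auto simp: pos_def)
  then have "(\<Sum>v<n. path_drdf n (pos v)) = (\<Sum>j<n. path_drdf n j)"
    by (rule sum.reindex_bij_betw)
  moreover have "dominated (if {cyc_pred n v, v} \<in> {e} then 1 else path_drdf n (pos (cyc_pred n v)))
      (path_drdf n (pos v))
      (if {v, cyc_succ n v} \<in> {e} then 1 else path_drdf n (pos (cyc_succ n v)))"
    if v: "v < n" for v
  proof -
    have lt: "pos v < n"
      using v i by (auto simp: pos_def)
    have pred: "{cyc_pred n v, v} = e \<longleftrightarrow> pos v = 0"
      using v i assms(1) by (auto simp: pos_def cyc_pred_def cyc_succ_def doubleton_eq_iff)
    have succ: "{v, cyc_succ n v} = e \<longleftrightarrow> Suc (pos v) = n"
      using v i assms(1) by (auto simp: pos_def cyc_succ_def doubleton_eq_iff)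
    have pos_pred: "pos (cyc_pred n v) = pos v - 1" if "pos v \<noteq> 0"
      using v i that by (auto simp: pos_def cyc_pred_def split: if_splits)
    have pos_succ: "pos (cyc_succ n v) = Suc (pos v)" if "Suc (pos v) \<noteq> n"
      using v i that by (auto simp: pos_def cyc_succ_def split: if_splits)
    have "dominated (if p = 0 then 1 else path_drdf n (p - 1)) (path_drdf n p)
        (if Suc p = n then 1 else path_drdf n (Suc p))" if "p < n" for p
    proof -
      have "p mod 3 = 0 \<or> p mod 3 = 1 \<or> p mod 3 = 2"
        by presburger
      then show ?thesis
        by (cases p) (auto simp: dominated_def path_drdf_def mod_Suc split: if_splits)
    qed
    from this[OF lt] show ?thesis
      using pred succ pos_pred pos_succ by (simp split: if_splits)
  qed
  ultimately show ?thesis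
    using gamma_dR_delete_edges_cycle_graph_le[OF assms(1), of "{e}" "\<lambda>v. path_drdf n (pos v)"]
      sum_path_drdf by simp
qed

lemma gamma_dR_even_cycle_graph_le:
  assumes "n \<ge> 3" "even n"
  shows "gamma_dR (cycle_graph n) \<le> n"
proof -
  let ?f = "\<lambda>v::nat. if even v then 2 else 0 :: nat"
  have "gamma_dR (delete_edges (cycle_graph n) {}) \<le> (\<Sum>v<n. ?f v)"
  proof (rule gamma_dR_delete_edges_cycle_graph_le[OF assms(1), of "{}" ?f])
    fix v assume "v < n"
    have "even (cyc_pred n v) \<longleftrightarrow> odd v" "even (cyc_succ n v) \<longleftrightarrow> odd v"
      using assms by (auto simp: cyc_pred_def cyc_succ_def)
    then show "dominated (if {cyc_pred n v, v} \<in> {} then 1 else ?f (cyc_pred n v)) (?f v)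
      (if {v, cyc_succ n v} \<in> {} then 1 else ?f (cyc_succ n v))"
      by (simp add: dominated_def)
  qed
  moreover have "(\<Sum>v<2 * k. ?f v) = 2 * k" for k
    by (induction k) auto
  ultimately show ?thesis
    using assms(2) delete_edges_empty by (metis evenE)
qed

lemma gamma_dR_cycle_graph_le_delete_edges:
  assumes "n \<ge> 3"
  shows "gamma_dR (cycle_graph n) \<le> gamma_dR (delete_edges (cycle_graph n) B)"
proof -
  obtain f where f: "gamma_dR (delete_edges (cycle_graph n) B) = (\<Sum>v<n. f v)"
    "\<And>v. v < n \<Longrightarrow> dominated (if {cyc_pred n v, v} \<in> B then 1 else f (cyc_pred n v)) (f v)
      (if {v, cyc_succ n v} \<in> B then 1 else f (cyc_succ n v))"
    using gamma_dR_delete_edges_cycle_graph_attained[OF assms] by blast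
  have "gamma_dR (delete_edges (cycle_graph n) {}) \<le> (\<Sum>v<n. f v)"
    using f(2) by (intro gamma_dR_delete_edges_cycle_graph_le[OF assms])
      (simp only: empty_iff if_False, rule dominated_restore)
  then show ?thesis
    using f(1) by (simp add: delete_edges_empty)
qed

section \<open>The bondage number\<close>

text \<open>Alternating 2 and 0 gives the cycle weight \<open>n\<close>, whereas the path left by
  one deletion costs \<open>n + 1\<close>.\<close>

lemma b_dR_cycle_graph_eq_1:
  assumes "n \<ge> 3" "even n" "\<not> 3 dvd n"
  shows "b_dR (cycle_graph n) = 1"
  unfolding b_dR_def
proof (rule Least_equality)
  have "{n - 1, 0} \<in> edges (cycle_graph n)"
    using cyc_succ_edge[of "n - 1" n] assms(1) by (simp add: cyc_succ_def)
  moreover have "gamma_dR (delete_edges (cycle_graph n) {{n - 1, 0}}) > gamma_dR (cycle_graph n)"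
    using gamma_dR_cycle_graph_delete_edge_ge[OF assms(1)] gamma_dR_even_cycle_graph_le[OF assms(1,2)]
      assms(3) by simp
  ultimately show "\<exists>B\<subseteq>edges (cycle_graph n). card B = 1 \<and>
      gamma_dR (delete_edges (cycle_graph n) B) > gamma_dR (cycle_graph n)"
    by (intro exI[of _ "{{n - 1, 0}}"]) simp
next
  fix k
  assume "\<exists>B\<subseteq>edges (cycle_graph n). card B = k \<and>
      gamma_dR (delete_edges (cycle_graph n) B) > gamma_dR (cycle_graph n)"
  then obtain B where B: "B \<subseteq> edges (cycle_graph n)" "card B = k"
    "gamma_dR (delete_edges (cycle_graph n) B) > gamma_dR (cycle_graph n)"
    by blast
  then have "B \<noteq> {}"
    by (auto simp: delete_edges_empty)
  moreover have "finite B"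
    using B(1) by (rule finite_subset) (simp add: edges_cycle_graph)
  ultimately show "1 \<le> k"
    using B(2) by (auto simp: Suc_le_eq card_gt_0_iff)
qed

text \<open>One deletion leaves a path no more expensive than the cycle itself. Two deletions can
  leave two paths with lengths not divisible by 3, costing at least \<open>n + 2\<close>, while the
  cycle costs at most \<open>n + 1\<close>.\<close>

lemma b_dR_cycle_graph_eq_2:
  assumes "n \<ge> 3" "odd n \<or> 3 dvd n"
  shows "b_dR (cycle_graph n) = 2"
  unfolding b_dR_def
proof (rule Least_equality)
  \<comment> \<open>The length 1 fails only for \<open>n mod 3 = 1\<close>, as then 3 divides
    \<open>n - 1\<close>; there the split into 2 and \<open>n - 2\<close> works.\<close>
  define a where "a = (if n mod 3 = 1 then 2 else 1 :: nat)"
  have a: "0 < a" "a + 1 < n" "\<not> 3 dvd a" "\<not> 3 dvd n - a"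
    using assms unfolding a_def by presburger+
  have edges: "{n - 1, 0} \<in> edges (cycle_graph n)" "{a - 1, a} \<in> edges (cycle_graph n)"
    using cyc_succ_edge[of "n - 1" n] cyc_succ_edge[of "a - 1" n] assms(1) a(1,2)
    by (simp_all add: cyc_succ_def)
  have "gamma_dR (cycle_graph n) \<le> n + 1"
    using gamma_dR_cycle_graph_delete_edge_le[OF assms(1) edges(1)]
      gamma_dR_cycle_graph_le_delete_edges[OF assms(1), of "{{n - 1, 0}}"] by (simp split: if_splits)
  then have "gamma_dR (delete_edges (cycle_graph n) {{n - 1, 0}, {a - 1, a}}) > gamma_dR (cycle_graph n)"
    using gamma_dR_cycle_graph_delete_two_edges_ge[OF assms(1) a(1,2)] a(3,4) by simp
  moreover have "{n - 1, 0} \<noteq> {a - 1, a}"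
    using a(1,2) by (auto simp: doubleton_eq_iff)
  then have "card {{n - 1, 0}, {a - 1, a}} = 2"
    by simp
  ultimately show "\<exists>B\<subseteq>edges (cycle_graph n). card B = 2 \<and>
      gamma_dR (delete_edges (cycle_graph n) B) > gamma_dR (cycle_graph n)"
    using edges by (intro exI[of _ "{{n - 1, 0}, {a - 1, a}}"]) simp
next
  fix k
  assume "\<exists>B\<subseteq>edges (cycle_graph n). card B = k \<and>
      gamma_dR (delete_edges (cycle_graph n) B) > gamma_dR (cycle_graph n)"
  then obtain B where B: "B \<subseteq> edges (cycle_graph n)" "card B = k"
    "gamma_dR (delete_edges (cycle_graph n) B) > gamma_dR (cycle_graph n)"
    by blast
  then have "B \<noteq> {}"
    by (auto simp: delete_edges_empty)
  moreover have "finite B"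
    using B(1) by (rule finite_subset) (simp add: edges_cycle_graph)
  ultimately have "k \<noteq> 0"
    using B(2) by auto
  moreover have "k \<noteq> 1"
  proof
    assume "k = 1"
    then obtain e where e: "B = {e}"
      using B(2) card_1_singletonE by blast
    then have "gamma_dR (delete_edges (cycle_graph n) B) \<le> n + (if 3 dvd n then 0 else 1)"
      using gamma_dR_cycle_graph_delete_edge_le[OF assms(1)] B(1) by simp
    \<comment> \<open>If 3 divides \<open>n\<close>, the left side is just \<open>n\<close>;
      otherwise \<open>n\<close> is odd and the cycle costs at least \<open>n + 1\<close>
      too.\<close>
    also have "\<dots> \<le> gamma_dR (cycle_graph n)"
      using gamma_dR_cycle_graph_ge[OF assms(1)] assms(2) by (auto split: if_splits)
    finally show False
      using B(3) by simp
  qed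
  ultimately show "2 \<le> k"
    by simp
qed

theorem theorem2p2:
  fixes n :: nat
  assumes "n \<ge> 3"
  shows "b_dR (cycle_graph n) = (if n mod 6 = 2 \<or> n mod 6 = 4 then 1 else 2)"
proof -
  have "n mod 6 = 2 \<or> n mod 6 = 4 \<longleftrightarrow> even n \<and> \<not> 3 dvd n"
    by presburger
  then show ?thesis
    using b_dR_cycle_graph_eq_1[OF assms] b_dR_cycle_graph_eq_2[OF assms] by auto
qed

end
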